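(* Let $\mathcal{N}$ be a network with $m$ message vectors, let $k_1,\dots,k_m\ge 0$ and $n,t\ge 1$ be integers, let ${}_R G$ be a module, and let $\mathcal{N}^{(k_1,\dots,k_m,n)}$ denote the network obtained from $\mathcal{N}$ by replacing each edge with $n$ parallel edges and replacing the $i$th message vector with $k_i$ message vectors (for each $i=1,\dots,m$). The network $\mathcal{N}$ has a $(tk_1,\dots,tk_m,tn)$ linear solution over ${}_R G$ if and only if $\mathcal{N}^{(k_1,\dots,k_m,n)}$ has a $t$-dimensional vector linear solution over ${}_R G$.
   Context: Rings are associative with identity $1$, not necessarily commutative. A module ${}_R G$ is a left (unital) $R$-module $G$ whose underlying Abelian group $G$ is finite; the ring $R$ need not be finite. A network is a finite directed acyclic multigraph, some of whose nodes are sources or receivers, with finitely many message vectors (say $m$ of them), each originating at a source node; each receiver demands a specified set of the message vectors. The inputs of a node are the message vectors originating at the node together with the vectors carried by its incoming edges. For integers $k_1,\dots,k_m\ge 0$ and $n\ge 1$, a $(k_1,\dots,k_m,n)$ code over a finite alphabet $\mathcal{A}$ (with $|\mathcal{A}|\ge 2$) lets the $i$th message vector range over $\mathcal{A}^{k_i}$, assigns to each edge an edge function mapping the inputs of the edge's tail node to a vector in $\mathcal{A}^n$ (the vector carried by the edge), and assigns to each receiver and each message vector it demands a decoding function of the receiver's inputs. The code is a solution if, for all values of the message vectors, each decoding function outputs the demanded message vector. A $t$-dimensional vector code is a code in which all message vectors and all edge vectors have block size $t$, i.e., a $(t,\dots,t,t)$ code. A code over the alphabet $\mathcal{A}=G$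 is linear over the module ${}_R G$ if every edge function and decoding function is of the form $\mathbf{x}\mapsto A\mathbf{x}$, where $\mathbf{x}$ is the concatenation (a vector over $G$) of the input vectors of the node, $A$ is a matrix with entries in $R$, and entries of $A$ multiply entries of $\mathbf{x}$ via the module action. In $\mathcal{N}^{(k_1,\dots,k_m,n)}$, the $k_i$ message vectors replacing the $i$th message vector of $\mathcal{N}$ originate at the same source node as, and are all demanded by the same receivers as, the $i$th message vector. *)

theory Defs
  imports
    "Graph_Theory.Digraph"
    "Jordan_Normal_Form.Matrix"
begin

section \<open>Modules over not necessarily commutative rings\<close>

text \<open>
  The distribution's \<open>module\<close> locales require a commutative ring.  The sort
  \<open>{ring, monoid_mult}\<close> is that of associative rings with identity; unlike
  \<open>ring_1\<close> it does not exclude the zero ring.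
\<close>

locale left_module =
  fixes scale :: "'r::{ring,monoid_mult} \<Rightarrow> 'g::ab_group_add \<Rightarrow> 'g" (infixr \<open>\<odot>\<close> 75)
  assumes scale_add_right: "a \<odot> (x + y) = a \<odot> x + a \<odot> y"
    and scale_add_left: "(a + b) \<odot> x = a \<odot> x + b \<odot> x"
    and scale_scale: "a \<odot> (b \<odot> x) = (a * b) \<odot> x"
    and scale_one: "1 \<odot> x = x"


section \<open>Networks\<close>

text \<open>
  The message vectors are labelled by an arbitrary finite set \<open>msgs N\<close>, whose
  cardinality is the number \<open>m\<close> of message vectors; a family \<open>k\<^sub>1, \<dots>, k\<^sub>m\<close> is
  accordingly a function on labels.  The field \<open>demands N\<close> is only relevant at
  receivers, and \<open>origin N\<close> only at elements of \<open>msgs N\<close>.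
\<close>

record ('v, 'e, 'm) network =
  graph :: "('v, 'e) pre_digraph"
  sources :: "'v set"
  receivers :: "'v set"
  msgs :: "'m set"
  origin :: "'m \<Rightarrow> 'v"
  demands :: "'v \<Rightarrow> 'm set"

definition wf_network :: "('v, 'e, 'm) network \<Rightarrow> bool" where
  "wf_network N \<longleftrightarrow>
     fin_digraph (graph N) \<and> acyclic (arcs_ends (graph N)) \<and>
     sources N \<subseteq> verts (graph N) \<and> receivers N \<subseteq> verts (graph N) \<and>
     finite (msgs N) \<and> (\<forall>i\<in>msgs N. origin N i \<in> sources N) \<and>
     (\<forall>v\<in>receivers N. demands N v \<subseteq> msgs N)"

text \<open>An input of a node is a message (\<open>Inl\<close>) or an incoming edge (\<open>Inr\<close>).\<close>

definition inputs :: "('v, 'e, 'm) network \<Rightarrow> 'v \<Rightarrow> ('m + 'e) set" where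
  "inputs N v = {i \<in> msgs N. origin N i = v} <+> in_arcs (graph N) v"

text \<open>
  The order in which the inputs of a node are listed, and hence concatenated, is
  arbitrary but fixed.  A different order amounts to a permutation of the
  arguments of edge and decoding functions, and of the columns of the matrices
  in the linear case.
\<close>

definition input_list :: "('v, 'e, 'm) network \<Rightarrow> 'v \<Rightarrow> ('m + 'e) list" where
  "input_list N v = (SOME is. distinct is \<and> set is = inputs N v)"

definition expand ::
    "('v, 'e, 'm) network \<Rightarrow> ('m \<Rightarrow> nat) \<Rightarrow> nat \<Rightarrow> ('v, 'e \<times> nat, 'm \<times> nat) network" where
  "expand N k n =
     \<lparr>graph = \<lparr>verts = verts (graph N),
               arcs = arcs (graph N) \<times> {..<n},
               tail = (\<lambda>(e, j). tail (graph N) e),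
               head = (\<lambda>(e, j). head (graph N) e)\<rparr>,
      sources = sources N,
      receivers = receivers N,
      msgs = (SIGMA i:msgs N. {..<k i}),
      origin = (\<lambda>(i, j). origin N i),
      demands = (\<lambda>v. SIGMA i:demands N v. {..<k i})\<rparr>"


section \<open>Codes and solutions\<close>

definition vectors :: "'a set \<Rightarrow> nat \<Rightarrow> 'a list set" where
  "vectors A n = {xs. length xs = n \<and> set xs \<subseteq> A}"

definition input_sizes ::
    "('v, 'e, 'm) network \<Rightarrow> ('m \<Rightarrow> nat) \<Rightarrow> nat \<Rightarrow> 'v \<Rightarrow> nat list" where
  "input_sizes N k n v = map (case_sum k (\<lambda>_. n)) (input_list N v)"

text \<open>
  The possible tuples of input vectors of a node: \<open>listset\<close> is the Cartesian
  product of a list of sets.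
\<close>

definition input_space ::
    "('v, 'e, 'm) network \<Rightarrow> 'a set \<Rightarrow> ('m \<Rightarrow> nat) \<Rightarrow> nat \<Rightarrow> 'v \<Rightarrow> 'a list list set" where
  "input_space N A k n v = listset (map (vectors A) (input_sizes N k n v))"

record ('v, 'e, 'm, 'a) code =
  edge_fun :: "'e \<Rightarrow> 'a list list \<Rightarrow> 'a list"
  dec_fun :: "'v \<Rightarrow> 'm \<Rightarrow> 'a list list \<Rightarrow> 'a list"

definition is_code ::
    "('v, 'e, 'm) network \<Rightarrow> 'a set \<Rightarrow> ('m \<Rightarrow> nat) \<Rightarrow> nat \<Rightarrow> ('v, 'e, 'm, 'a) code \<Rightarrow> bool" where
  "is_code N A k n C \<longleftrightarrow>
     finite A \<and> 2 \<le> card A \<and> 1 \<le> n \<and>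
     (\<forall>e\<in>arcs (graph N). \<forall>xs\<in>input_space N A k n (tail (graph N) e).
        edge_fun C e xs \<in> vectors A n) \<and>
     (\<forall>v\<in>receivers N. \<forall>i\<in>demands N v. \<forall>xs\<in>input_space N A k n v.
        dec_fun C v i xs \<in> vectors A (k i))"

definition input_vals ::
    "('v, 'e, 'm) network \<Rightarrow> ('m \<Rightarrow> 'a list) \<Rightarrow> ('e \<Rightarrow> 'a list) \<Rightarrow> 'v \<Rightarrow> 'a list list" where
  "input_vals N x y v = map (case_sum x y) (input_list N v)"

text \<open>
  \<open>carried N C x y\<close>: \<open>y\<close> gives the vectors carried by the edges when the
  message vectors take the values \<open>x\<close>.  Such a \<open>y\<close> exists and is unique on the
  edges of the network, see \<open>carried_ex\<close> and \<open>carried_unique\<close> below.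
\<close>

definition carried ::
    "('v, 'e, 'm) network \<Rightarrow> ('v, 'e, 'm, 'a) code \<Rightarrow> ('m \<Rightarrow> 'a list) \<Rightarrow> ('e \<Rightarrow> 'a list) \<Rightarrow> bool" where
  "carried N C x y \<longleftrightarrow>
     (\<forall>e\<in>arcs (graph N). y e = edge_fun C e (input_vals N x y (tail (graph N) e)))"

definition is_solution ::
    "('v, 'e, 'm) network \<Rightarrow> 'a set \<Rightarrow> ('m \<Rightarrow> nat) \<Rightarrow> nat \<Rightarrow> ('v, 'e, 'm, 'a) code \<Rightarrow> bool" where
  "is_solution N A k n C \<longleftrightarrow>
     is_code N A k n C \<and>
     (\<forall>x y. (\<forall>i\<in>msgs N. x i \<in> vectors A (k i)) \<and> carried N C x y \<longrightarrow>
        (\<forall>v\<in>receivers N. \<forall>i\<in>demands N v. dec_fun C v i (input_vals N x y v) = x i))"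


section \<open>Linear codes\<close>

definition mat_act ::
    "('r \<Rightarrow> 'g \<Rightarrow> 'g) \<Rightarrow> 'r mat \<Rightarrow> 'g::comm_monoid_add list \<Rightarrow> 'g list" where
  "mat_act scale M xs = map (\<lambda>i. \<Sum>j<dim_col M. scale (M $$ (i, j)) (xs ! j)) [0..<dim_row M]"

definition is_linear_fun ::
    "('r \<Rightarrow> 'g \<Rightarrow> 'g) \<Rightarrow> ('v, 'e, 'm) network \<Rightarrow> ('m \<Rightarrow> nat) \<Rightarrow> nat \<Rightarrow> 'v \<Rightarrow> nat \<Rightarrow>
     ('g::comm_monoid_add list list \<Rightarrow> 'g list) \<Rightarrow> bool" where
  "is_linear_fun scale N k n v d f \<longleftrightarrow>
     (\<exists>M\<in>carrier_mat d (sum_list (input_sizes N k n v)).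
        \<forall>xs\<in>input_space N UNIV k n v. f xs = mat_act scale M (concat xs))"

definition is_linear_code ::
    "('r \<Rightarrow> 'g \<Rightarrow> 'g) \<Rightarrow> ('v, 'e, 'm) network \<Rightarrow> ('m \<Rightarrow> nat) \<Rightarrow> nat \<Rightarrow>
     ('v, 'e, 'm, 'g::comm_monoid_add) code \<Rightarrow> bool" where
  "is_linear_code scale N k n C \<longleftrightarrow>
     is_code N UNIV k n C \<and>
     (\<forall>e\<in>arcs (graph N). is_linear_fun scale N k n (tail (graph N) e) n (edge_fun C e)) \<and>
     (\<forall>v\<in>receivers N. \<forall>i\<in>demands N v. is_linear_fun scale N k n v (k i) (dec_fun C v i))"

definition has_linear_solution ::
    "('r \<Rightarrow> 'g \<Rightarrow> 'g::comm_monoid_add) \<Rightarrow> ('v, 'e, 'm) network \<Rightarrow> ('m \<Rightarrow> nat) \<Rightarrow> nat \<Rightarrow> bool" where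
  "has_linear_solution scale N k n \<longleftrightarrow>
     (\<exists>C. is_linear_code scale N k n C \<and> is_solution N UNIV k n C)"

definition has_vector_linear_solution ::
    "('r \<Rightarrow> 'g \<Rightarrow> 'g::comm_monoid_add) \<Rightarrow> ('v, 'e, 'm) network \<Rightarrow> nat \<Rightarrow> bool" where
  "has_vector_linear_solution scale N t \<longleftrightarrow> has_linear_solution scale N (\<lambda>_. t) t"


section \<open>Basic facts\<close>

lemma finite_inputs:
  assumes "wf_network N"
  shows "finite (inputs N v)"
proof -
  have "finite (msgs N)" "finite (arcs (graph N))"
    using assms by (auto simp: wf_network_def fin_digraph_def fin_digraph_axioms_def)
  then show ?thesis
    by (simp add: inputs_def in_arcs_def)
qed

lemma input_list:
  assumes "wf_network N"
  shows "distinct (input_list N v)" "set (input_list N v) = inputs N v"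
proof -
  have "\<exists>is. distinct is \<and> set is = inputs N v"
    using finite_distinct_list[OF finite_inputs[OF assms]] by blast
  then have "distinct (input_list N v) \<and> set (input_list N v) = inputs N v"
    unfolding input_list_def by (rule someI_ex)
  then show "distinct (input_list N v)" "set (input_list N v) = inputs N v"
    by auto
qed

lemma arcs_ends_expand:
  "arcs_ends (graph (expand N k n)) \<subseteq> arcs_ends (graph N)"
  by (auto simp: expand_def arcs_ends_conv)

lemma wf_network_expand:
  assumes "wf_network N"
  shows "wf_network (expand N k n)"
proof -
  have "acyclic (arcs_ends (graph (expand N k n)))"
    using assms arcs_ends_expand[of N k n] acyclic_subset unfolding wf_network_def by blast
  then show ?thesis
    using assms
    by (auto simp: wf_network_def expand_def fin_digraph_def fin_digraph_axioms_def
        wf_digraph_def)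
qed

definition edge_order :: "('v, 'e, 'm) network \<Rightarrow> ('e \<times> 'e) set" where
  "edge_order N = {(d, e). d \<in> arcs (graph N) \<and> e \<in> arcs (graph N) \<and>
     head (graph N) d = tail (graph N) e}"

lemma wf_edge_order:
  assumes "wf_network N"
  shows "wf (edge_order N)"
proof (rule finite_acyclic_wf)
  have "finite (arcs (graph N))"
    using assms by (auto simp: wf_network_def fin_digraph_def fin_digraph_axioms_def)
  moreover have "edge_order N \<subseteq> arcs (graph N) \<times> arcs (graph N)"
    by (auto simp: edge_order_def)
  ultimately show "finite (edge_order N)"
    using finite_subset by blast
  have *: "(tail (graph N) d, tail (graph N) e) \<in> (arcs_ends (graph N))\<^sup>+"
    if "(d, e) \<in> (edge_order N)\<^sup>+" for d e
    using that
  proof (induction rule: trancl_induct)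
    case (base e)
    then show ?case
      by (auto simp: edge_order_def arcs_ends_conv intro!: r_into_trancl image_eqI[of _ _ d])
  next
    case (step e f)
    then have "(tail (graph N) e, tail (graph N) f) \<in> arcs_ends (graph N)"
      by (auto simp: edge_order_def arcs_ends_conv intro!: image_eqI[of _ _ e])
    with step.IH show ?case
      by (rule trancl_into_trancl)
  qed
  show "acyclic (edge_order N)"
    using * assms unfolding acyclic_def wf_network_def by blast
qed

lemma input_vals_cong:
  assumes "wf_network N"
    and "\<And>i. i \<in> msgs N \<Longrightarrow> x i = x' i"
    and "\<And>d. d \<in> arcs (graph N) \<Longrightarrow> head (graph N) d = v \<Longrightarrow> y d = y' d"
  shows "input_vals N x y v = input_vals N x' y' v"
  unfolding input_vals_def
  by (rule map_cong) (auto simp: input_list[OF assms(1)] inputs_def in_arcs_def assms(2,3))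

lemma carried_ex:
  assumes "wf_network N"
  shows "\<exists>y. carried N C x y"
proof -
  define F where "F = (\<lambda>y e. edge_fun C e (input_vals N x y (tail (graph N) e)))"
  define y where "y = wfrec (edge_order N) F"
  have "y e = F y e" if "e \<in> arcs (graph N)" for e
  proof -
    have "y e = F (cut y (edge_order N) e) e"
      unfolding y_def by (rule wfrec[OF wf_edge_order[OF assms]])
    also have "\<dots> = F y e"
      unfolding F_def using that
      by (intro arg_cong[where f = "edge_fun C e"] input_vals_cong[OF assms])
        (auto simp: cut_def edge_order_def)
    finally show ?thesis .
  qed
  then show ?thesis
    unfolding carried_def F_def by blast
qed

lemma carried_unique:
  assumes "wf_network N" "carried N C x y" "carried N C x y'" "e \<in> arcs (graph N)"
  shows "y e = y' e"
  using wf_edge_order[OF assms(1)] assms(4)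
proof (induction e rule: wf_induct_rule)
  case (less e)
  have "input_vals N x y (tail (graph N) e) = input_vals N x y' (tail (graph N) e)"
    by (rule input_vals_cong[OF assms(1)]) (auto simp: edge_order_def less)
  then show ?case
    using assms(2,3) less.prems unfolding carried_def by metis
qed

end

theory Submission
  imports Defs
begin

text \<open>
  Whether a linear solution exists depends only on the scalar coefficients with which a component
  of an input enters a component of an output, indexed by the input itself and not by its place in
  the concatenated input vector.  In this form, a block of length \<open>t * d\<close> is the same as \<open>d\<close> blocks
  of length \<open>t\<close>: component \<open>q\<close> of the long block is component \<open>q mod t\<close> of the short block
  \<open>q div t\<close>.
\<close>

section \<open>Linear solutions in terms of coefficients\<close>

abbreviation input_size :: "('m \<Rightarrow> nat) \<Rightarrow> nat \<Rightarrow> 'm + 'e \<Rightarrow> nat" where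
  "input_size k n \<equiv> case_sum k (\<lambda>_. n)"

definition node_comb ::
    "('r \<Rightarrow> 'g \<Rightarrow> 'g::comm_monoid_add) \<Rightarrow> ('v, 'e, 'm) network \<Rightarrow> ('m \<Rightarrow> nat) \<Rightarrow> nat \<Rightarrow> 'v \<Rightarrow>
     ('m + 'e \<Rightarrow> nat \<Rightarrow> 'r) \<Rightarrow> ('m + 'e \<Rightarrow> nat \<Rightarrow> 'g) \<Rightarrow> 'g" where
  "node_comb scale N k n v c X =
     (\<Sum>p\<in>inputs N v. \<Sum>q<input_size k n p. scale (c p q) (X p q))"

text \<open>\<open>X\<close> bundles the components of messages and edges. Message components are
  free, so ranging over all \<open>X\<close> covers all message values; components beyond the block
  sizes are never read. \<open>a e r\<close> and \<open>b v i r\<close> stand for row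
  \<open>r\<close> of the matrix of an edge and of a decoder.\<close>

definition coeff_solution ::
    "('r \<Rightarrow> 'g \<Rightarrow> 'g::comm_monoid_add) \<Rightarrow> ('v, 'e, 'm) network \<Rightarrow> ('m \<Rightarrow> nat) \<Rightarrow> nat \<Rightarrow>
     ('e \<Rightarrow> nat \<Rightarrow> 'm + 'e \<Rightarrow> nat \<Rightarrow> 'r) \<Rightarrow> ('v \<Rightarrow> 'm \<Rightarrow> nat \<Rightarrow> 'm + 'e \<Rightarrow> nat \<Rightarrow> 'r) \<Rightarrow> bool" where
  "coeff_solution scale N k n a b \<longleftrightarrow>
     (\<forall>X. (\<forall>e\<in>arcs (graph N). \<forall>r<n.
             X (Inr e) r = node_comb scale N k n (tail (graph N) e) (a e r) X) \<longrightarrow>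
          (\<forall>v\<in>receivers N. \<forall>i\<in>demands N v. \<forall>r<k i.
             node_comb scale N k n v (b v i r) X = X (Inl i) r))"

section \<open>Concatenated vectors versus coefficients per input\<close>

lemma sum_lessThan_add:
  fixes f :: "nat \<Rightarrow> 'a::comm_monoid_add"
  shows "(\<Sum>j<m + n. f j) = (\<Sum>j<m. f j) + (\<Sum>j<n. f (m + j))"
  by (induction n) (simp_all add: ac_simps)

lemma sum_concat_Cons:
  fixes scale :: "'r \<Rightarrow> 'g \<Rightarrow> 'g::comm_monoid_add"
  assumes "length (z i) = s i"
  shows "(\<Sum>j<sum_list (map s (i # is)). scale (a j) (concat (map z (i # is)) ! j)) =
    (\<Sum>j<s i. scale (a j) (z i ! j)) +
    (\<Sum>j<sum_list (map s is). scale (a (s i + j)) (concat (map z is) ! j))"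
  using assms by (simp add: sum_lessThan_add nth_append)

text \<open>The family \<open>c\<close> is chosen before \<open>z\<close>: coefficients may depend
  on the linear map but not on the vectors. Distinctness lets each input own exactly one block of
  positions, whose coefficients become those of the input.\<close>

lemma position_coeffs_to_input_coeffs:
  fixes scale :: "'r \<Rightarrow> 'g \<Rightarrow> 'g::comm_monoid_add"
  assumes "distinct is"
  shows "\<exists>c. \<forall>z. (\<forall>p\<in>set is. length (z p) = s p) \<longrightarrow>
    (\<Sum>j<sum_list (map s is). scale (a j) (concat (map z is) ! j)) =
    (\<Sum>p\<in>set is. \<Sum>q<s p. scale (c p q) (z p ! q))"
  using assms
proof (induction "is" arbitrary: a)
  case Nil
  show ?case by simp
next
  case (Cons i "is")
  obtain c where c: "\<And>z. \<forall>p\<in>set is. length (z p) = s p \<Longrightarrow>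
      (\<Sum>j<sum_list (map s is). scale (a (s i + j)) (concat (map z is) ! j)) =
      (\<Sum>p\<in>set is. \<Sum>q<s p. scale (c p q) (z p ! q))"
    using Cons.IH[of "\<lambda>j. a (s i + j)"] Cons.prems by auto
  \<comment> \<open>In the first block, positions and component indices coincide, so
    \<open>a\<close> itself serves as the coefficients of \<open>i\<close>; as \<open>i\<close> does
    not occur in \<open>is\<close>, the update leaves the others alone.\<close>
  have "(\<Sum>j<sum_list (map s (i # is)). scale (a j) (concat (map z (i # is)) ! j)) =
      (\<Sum>p\<in>set (i # is). \<Sum>q<s p. scale ((c(i := a)) p q) (z p ! q))"
    if z: "\<forall>p\<in>set (i # is). length (z p) = s p" for z
  proof -
    have "(\<Sum>p\<in>set is. \<Sum>q<s p. scale ((c(i := a)) p q) (z p ! q)) =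
        (\<Sum>p\<in>set is. \<Sum>q<s p. scale (c p q) (z p ! q))"
      using Cons.prems by (intro sum.cong) auto
    moreover have "length (z i) = s i" "\<forall>p\<in>set is. length (z p) = s p"
      using z by auto
    ultimately show ?thesis
      using Cons.prems by (subst sum_concat_Cons) (simp_all add: c)
  qed
  then show ?case by blast
qed

lemma input_coeffs_to_position_coeffs:
  fixes scale :: "'r \<Rightarrow> 'g \<Rightarrow> 'g::comm_monoid_add"
  assumes "distinct is"
  shows "\<exists>a. \<forall>z. (\<forall>p\<in>set is. length (z p) = s p) \<longrightarrow>
    (\<Sum>j<sum_list (map s is). scale (a j) (concat (map z is) ! j)) =
    (\<Sum>p\<in>set is. \<Sum>q<s p. scale (c p q) (z p ! q))"
  using assms
proof (induction "is")
  case Nil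
  show ?case by simp
next
  case (Cons i "is")
  obtain a where a: "\<And>z. \<forall>p\<in>set is. length (z p) = s p \<Longrightarrow>
      (\<Sum>j<sum_list (map s is). scale (a j) (concat (map z is) ! j)) =
      (\<Sum>p\<in>set is. \<Sum>q<s p. scale (c p q) (z p ! q))"
    using Cons.IH Cons.prems by auto
  \<comment> \<open>Positions below \<open>s i\<close> lie in the block of \<open>i\<close>; later
    ones are shifted by its length.\<close>
  define a' where "a' j = (if j < s i then c i j else a (j - s i))" for j
  have "(\<Sum>j<sum_list (map s (i # is)). scale (a' j) (concat (map z (i # is)) ! j)) =
      (\<Sum>p\<in>set (i # is). \<Sum>q<s p. scale (c p q) (z p ! q))"
    if z: "\<forall>p\<in>set (i # is). length (z p) = s p" for z
  proof -
    have "length (z i) = s i" "\<forall>p\<in>set is. length (z p) = s p"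
      using z by auto
    then show ?thesis
      using Cons.prems by (subst sum_concat_Cons) (simp_all add: a a'_def)
  qed
  then show ?case by blast
qed

lemma input_vals_in_input_space:
  assumes "wf_network N"
    and "\<And>p. p \<in> inputs N v \<Longrightarrow> length (case_sum x y p) = input_size k n p"
  shows "input_vals N x y v \<in> input_space N UNIV k n v"
proof -
  \<comment> \<open>Generalised to any list of inputs, because \<open>input_list\<close> is an
    arbitrary choice and offers no induction.\<close>
  have "map (case_sum x y) is \<in> listset (map (vectors UNIV) (map (input_size k n) is))"
    if "set is \<subseteq> inputs N v" for "is"
    using that by (induction "is") (auto simp: set_Cons_def vectors_def assms(2))
  then show ?thesis
    unfolding input_vals_def input_space_def input_sizes_def
    using input_list(2)[OF assms(1)] by blast
qed

lemma mat_act_input_vals_nth: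
  fixes scale :: "'r \<Rightarrow> 'g \<Rightarrow> 'g::comm_monoid_add"
  assumes "M \<in> carrier_mat d (sum_list (input_sizes N k n v))" "r < d"
  shows "mat_act scale M (concat (input_vals N x y v)) ! r =
    (\<Sum>j<sum_list (map (input_size k n) (input_list N v)).
       scale (M $$ (r, j)) (concat (map (case_sum x y) (input_list N v)) ! j))"
  using assms unfolding mat_act_def input_vals_def input_sizes_def by simp

lemma length_mat_act [simp]: "length (mat_act scale M xs) = dim_row M"
  by (simp add: mat_act_def)

lemma matrix_to_input_coeffs:
  fixes scale :: "'r \<Rightarrow> 'g \<Rightarrow> 'g::comm_monoid_add"
  assumes N: "wf_network N"
    and M: "M \<in> carrier_mat d (sum_list (input_sizes N k n v))"
  shows "\<exists>c. \<forall>x y. (\<forall>p\<in>inputs N v. length (case_sum x y p) = input_size k n p) \<longrightarrow>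
    (\<forall>r<d. mat_act scale M (concat (input_vals N x y v)) ! r =
      node_comb scale N k n v (c r) (\<lambda>p q. case_sum x y p ! q))"
proof -
  \<comment> \<open>One coefficient family per row, collected by \<open>choice\<close>. Indices
    \<open>r \<ge> d\<close> are included only to avoid a side condition; nothing is concluded about
    them.\<close>
  have "\<forall>r. \<exists>c. \<forall>z. (\<forall>p\<in>inputs N v. length (z p) = input_size k n p) \<longrightarrow>
      (\<Sum>j<sum_list (map (input_size k n) (input_list N v)).
        scale (M $$ (r, j)) (concat (map z (input_list N v)) ! j)) =
      node_comb scale N k n v c (\<lambda>p q. z p ! q)"
    using position_coeffs_to_input_coeffs[OF input_list(1)[OF N, of v],
      where s = "input_size k n" and scale = scale and a = "\<lambda>j. M $$ (r, j)" for r]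
    by (intro allI) (simp only: node_comb_def input_list(2)[OF N])
  then have "\<exists>c. \<forall>r z. (\<forall>p\<in>inputs N v. length (z p) = input_size k n p) \<longrightarrow>
      (\<Sum>j<sum_list (map (input_size k n) (input_list N v)).
        scale (M $$ (r, j)) (concat (map z (input_list N v)) ! j)) =
      node_comb scale N k n v (c r) (\<lambda>p q. z p ! q)"
    by (rule choice)
  then obtain c where "\<forall>r z. (\<forall>p\<in>inputs N v. length (z p) = input_size k n p) \<longrightarrow>
      (\<Sum>j<sum_list (map (input_size k n) (input_list N v)).
        scale (M $$ (r, j)) (concat (map z (input_list N v)) ! j)) =
      node_comb scale N k n v (c r) (\<lambda>p q. z p ! q)"
    by (rule exE)
  then show ?thesis
    by (intro exI[of _ c]) (simp add: mat_act_input_vals_nth[OF M])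
qed

text \<open>This supplies the matrices when a code is built from coefficients: row \<open>r\<close>
  lists the coefficients \<open>c r\<close> in the order of \<open>input_list\<close>.\<close>

lemma input_coeffs_to_matrix:
  fixes scale :: "'r \<Rightarrow> 'g \<Rightarrow> 'g::comm_monoid_add"
  assumes N: "wf_network N"
  shows "\<exists>M\<in>carrier_mat d (sum_list (input_sizes N k n v)).
    \<forall>x y. (\<forall>p\<in>inputs N v. length (case_sum x y p) = input_size k n p) \<longrightarrow>
    (\<forall>r<d. mat_act scale M (concat (input_vals N x y v)) ! r =
      node_comb scale N k n v (c r) (\<lambda>p q. case_sum x y p ! q))"
proof -
  have "\<forall>r. \<exists>a. \<forall>z. (\<forall>p\<in>inputs N v. length (z p) = input_size k n p) \<longrightarrow>
      (\<Sum>j<sum_list (map (input_size k n) (input_list N v)).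
        scale (a j) (concat (map z (input_list N v)) ! j)) =
      node_comb scale N k n v (c r) (\<lambda>p q. z p ! q)"
    using input_coeffs_to_position_coeffs[OF input_list(1)[OF N, of v],
      where s = "input_size k n" and scale = scale and c = "c r" for r]
    by (intro allI) (simp only: node_comb_def input_list(2)[OF N])
  then have "\<exists>a. \<forall>r z. (\<forall>p\<in>inputs N v. length (z p) = input_size k n p) \<longrightarrow>
      (\<Sum>j<sum_list (map (input_size k n) (input_list N v)).
        scale (a r j) (concat (map z (input_list N v)) ! j)) =
      node_comb scale N k n v (c r) (\<lambda>p q. z p ! q)"
    by (rule choice)
  then obtain a where a: "\<forall>r z. (\<forall>p\<in>inputs N v. length (z p) = input_size k n p) \<longrightarrow>
      (\<Sum>j<sum_list (map (input_size k n) (input_list N v)).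
        scale (a r j) (concat (map z (input_list N v)) ! j)) =
      node_comb scale N k n v (c r) (\<lambda>p q. z p ! q)"
    by (rule exE)
  define M where "M = mat d (sum_list (input_sizes N k n v)) (\<lambda>(r, j). a r j)"
  have M: "M \<in> carrier_mat d (sum_list (input_sizes N k n v))"
    by (simp add: M_def)
  have "M $$ (r, j) = a r j"
    if "r < d" "j < sum_list (map (input_size k n) (input_list N v))" for r j
    using that by (simp add: M_def input_sizes_def)
  then show ?thesis
    using M a by (intro bexI[of _ M]) (simp_all add: mat_act_input_vals_nth[OF M])
qed

section \<open>Codes versus systems of coefficients\<close>

lemma node_comb_cong:
  assumes "\<And>p q. p \<in> inputs N v \<Longrightarrow> q < input_size k n p \<Longrightarrow> X p q = X' p q"
  shows "node_comb scale N k n v c X = node_comb scale N k n v c X'"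
  unfolding node_comb_def using assms by (intro sum.cong) auto

text \<open>With the coefficients read off the matrices, an \<open>X\<close> satisfying the edge
  equations describes an actual run of the code, and there the decoders succeed.\<close>

lemma coeff_solution_of_linear_solution:
  fixes scale :: "'r \<Rightarrow> 'g \<Rightarrow> 'g::comm_monoid_add"
  assumes N: "wf_network N"
    and lin: "is_linear_code scale N k n C" and sol: "is_solution N UNIV k n C"
  shows "\<exists>a b. coeff_solution scale N k n a b"
proof -
  \<comment> \<open>The length clause is what permits proving equality of vectors entry by
    entry.\<close>
  define repr where "repr v d f c \<longleftrightarrow>
      (\<forall>x y. (\<forall>p\<in>inputs N v. length (case_sum x y p) = input_size k n p) \<longrightarrow>
        length (f (input_vals N x y v)) = d \<and>
        (\<forall>r<d. f (input_vals N x y v) ! r =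
          node_comb scale N k n v (c r) (\<lambda>p q. case_sum x y p ! q)))" for v d f c
  have coeffs: "\<exists>c. repr v d f c" if linear: "is_linear_fun scale N k n v d f" for v d f
  proof -
    obtain M where M: "M \<in> carrier_mat d (sum_list (input_sizes N k n v))"
      and f: "\<And>xs. xs \<in> input_space N UNIV k n v \<Longrightarrow> f xs = mat_act scale M (concat xs)"
      using linear unfolding is_linear_fun_def by blast
    show ?thesis
      using matrix_to_input_coeffs[OF N M, of scale] M unfolding repr_def
      by (auto simp: f input_vals_in_input_space[OF N])
  qed
  have "\<forall>e. \<exists>c. e \<in> arcs (graph N) \<longrightarrow> repr (tail (graph N) e) n (edge_fun C e) c"
    using lin coeffs unfolding is_linear_code_def by blast
  then obtain a where a: "\<And>e. e \<in> arcs (graph N) \<Longrightarrow>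
      repr (tail (graph N) e) n (edge_fun C e) (a e)"
    by metis
  have "\<forall>v i. \<exists>c. v \<in> receivers N \<longrightarrow> i \<in> demands N v \<longrightarrow> repr v (k i) (dec_fun C v i) c"
    using lin coeffs unfolding is_linear_code_def by blast
  then obtain b where b: "\<And>v i. v \<in> receivers N \<Longrightarrow> i \<in> demands N v \<Longrightarrow>
      repr v (k i) (dec_fun C v i) (b v i)"
    by metis
  have "node_comb scale N k n v (b v i r) X = X (Inl i) r"
    if X: "\<forall>e\<in>arcs (graph N). \<forall>r<n.
             X (Inr e) r = node_comb scale N k n (tail (graph N) e) (a e r) X"
      and v: "v \<in> receivers N" and i: "i \<in> demands N v" and r: "r < k i" for X v i r
  proof -
    \<comment> \<open>Truncating \<open>X\<close> to the block sizes gives vectors of the right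
      length for every input, and \<open>node_comb\<close> does not notice the truncation.\<close>
    define x where "x i = map (X (Inl i)) [0..<k i]" for i
    define y where "y e = map (X (Inr e)) [0..<n]" for e
    have len: "length (case_sum x y p) = input_size k n p" for p
      by (cases p) (simp_all add: x_def y_def)
    have nth: "case_sum x y p ! q = X p q" if "q < input_size k n p" for p q
      using that by (cases p) (simp_all add: x_def y_def)
    have comb: "node_comb scale N k n w c (\<lambda>p q. case_sum x y p ! q) = node_comb scale N k n w c X"
      for w c
      by (rule node_comb_cong) (simp add: nth)
    have "carried N C x y"
      unfolding carried_def
    proof
      fix e assume e: "e \<in> arcs (graph N)"
      show "y e = edge_fun C e (input_vals N x y (tail (graph N) e))"
        using a[OF e, unfolded repr_def, rule_format, of x y] len X e
        by (intro nth_equalityI) (simp_all add: y_def[of e] comb)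
    qed
    moreover have "\<forall>i\<in>msgs N. x i \<in> vectors UNIV (k i)"
      by (simp add: vectors_def x_def)
    ultimately have "dec_fun C v i (input_vals N x y v) = x i"
      using sol v i unfolding is_solution_def by blast
    then show ?thesis
      using b[OF v i, unfolded repr_def, rule_format, of x y] len r nth[of r "Inl i"]
      by (simp add: comb)
  qed
  then show ?thesis
    unfolding coeff_solution_def by blast
qed

text \<open>Matrices assembled from the coefficients define the code. Any run of it, read entry by
  entry, satisfies the edge equations and hence the decoding equations.\<close>

lemma linear_solution_of_coeff_solution:
  fixes scale :: "'r \<Rightarrow> 'g \<Rightarrow> 'g::{comm_monoid_add,finite}"
  assumes N: "wf_network N" and card: "2 \<le> card (UNIV :: 'g set)" and n: "1 \<le> n"
    and ab: "coeff_solution scale N k n a b"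
  shows "has_linear_solution scale N k n"
proof -
  define repr where "repr v d c M \<longleftrightarrow>
      M \<in> carrier_mat d (sum_list (input_sizes N k n v)) \<and>
      (\<forall>x y. (\<forall>p\<in>inputs N v. length (case_sum x y p) = input_size k n p) \<longrightarrow>
        (\<forall>r<d. mat_act scale M (concat (input_vals N x y v)) ! r =
          node_comb scale N k n v (c r) (\<lambda>p q. case_sum x y p ! q)))" for v d c M
  have matrix: "\<exists>M. repr v d c M" for v d c
    unfolding repr_def using input_coeffs_to_matrix[OF N] by (simp only: Bex_def)
  define P where "P e = (SOME M. repr (tail (graph N) e) n (a e) M)" for e
  have P_repr: "repr (tail (graph N) e) n (a e) (P e)" for e
    unfolding P_def by (rule someI_ex[OF matrix])
  define Q where "Q v i = (SOME M. repr v (k i) (b v i) M)" for v i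
  have Q_repr: "repr v (k i) (b v i) (Q v i)" for v i
    unfolding Q_def by (rule someI_ex[OF matrix])
  note P = P_repr[unfolded repr_def, THEN conjunct1]
    and P_act = P_repr[unfolded repr_def, THEN conjunct2, rule_format]
    and Q = Q_repr[unfolded repr_def, THEN conjunct1]
    and Q_act = Q_repr[unfolded repr_def, THEN conjunct2, rule_format]
  define C where "C = \<lparr>edge_fun = \<lambda>e xs. mat_act scale (P e) (concat xs),
    dec_fun = \<lambda>v i xs. mat_act scale (Q v i) (concat xs)\<rparr>"
  have dims: "dim_row (P e) = n" "dim_row (Q v i) = k i" for e v i
    using P[of e] Q[of v i] by auto
  have code: "is_code N UNIV k n C"
    using card n by (simp add: is_code_def C_def vectors_def dims)
  have "is_linear_code scale N k n C"
    unfolding is_linear_code_def is_linear_fun_def C_def using code P Q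
    by (auto simp: C_def)
  moreover have "is_solution N UNIV k n C"
    unfolding is_solution_def
  proof (intro conjI code allI impI ballI)
    fix x y v i
    assume xy: "(\<forall>i\<in>msgs N. x i \<in> vectors UNIV (k i)) \<and> carried N C x y"
      and v: "v \<in> receivers N" and i: "i \<in> demands N v"
    have y: "y e = mat_act scale (P e) (concat (input_vals N x y (tail (graph N) e)))"
      if "e \<in> arcs (graph N)" for e
      using xy that unfolding carried_def C_def by simp
    \<comment> \<open>Every edge vector is a matrix product with \<open>n\<close> rows, so its
      length is known at once, without induction along the network.\<close>
    have len: "length (case_sum x y p) = input_size k n p" if "p \<in> inputs N w" for p w
      using xy that by (auto simp: inputs_def in_arcs_def vectors_def y dims)
    define X where "X p q = case_sum x y p ! q" for p q
    have "\<forall>e\<in>arcs (graph N). \<forall>r<n.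
        X (Inr e) r = node_comb scale N k n (tail (graph N) e) (a e r) X"
      using P_act[OF len] by (simp add: X_def[abs_def] y)
    then have b: "node_comb scale N k n v (b v i r) X = X (Inl i) r" if "r < k i" for r
      using ab v i that unfolding coeff_solution_def by blast
    have "i \<in> msgs N"
      using N v i unfolding wf_network_def by blast
    then have "length (x i) = k i"
      using xy by (simp add: vectors_def)
    then show "dec_fun C v i (input_vals N x y v) = x i"
      using b by (intro nth_equalityI) (simp_all add: C_def dims Q_act[OF len] X_def[abs_def])
  qed
  ultimately show ?thesis
    unfolding has_linear_solution_def by blast
qed

text \<open>The first two conjuncts are the requirements of \<open>is_code\<close> that the
  coefficients do not record.\<close>

lemma has_linear_solution_iff_coeff_solution:
  fixes scale :: "'r \<Rightarrow> 'g \<Rightarrow> 'g::{comm_monoid_add,finite}"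
  assumes "wf_network N"
  shows "has_linear_solution scale N k n \<longleftrightarrow>
    2 \<le> card (UNIV :: 'g set) \<and> 1 \<le> n \<and> (\<exists>a b. coeff_solution scale N k n a b)"
proof
  assume "has_linear_solution scale N k n"
  then obtain C where C: "is_linear_code scale N k n C" "is_solution N UNIV k n C"
    unfolding has_linear_solution_def by auto
  then have "is_code N UNIV k n C"
    by (simp add: is_solution_def)
  then show "2 \<le> card (UNIV :: 'g set) \<and> 1 \<le> n \<and> (\<exists>a b. coeff_solution scale N k n a b)"
    using coeff_solution_of_linear_solution[OF assms C] by (simp add: is_code_def)
qed (auto intro: linear_solution_of_coeff_solution[OF assms])


section \<open>Splitting blocks\<close>

text \<open>Block \<open>j\<close> of an input of the original network is the \<open>j\<close>th
  copy of that message or edge in the expanded one.\<close>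

definition split_input :: "'m + 'e \<Rightarrow> nat \<Rightarrow> 'm \<times> nat + 'e \<times> nat" where
  "split_input p j = map_sum (\<lambda>i. (i, j)) (\<lambda>e. (e, j)) p"

definition merge_blocks :: "nat \<Rightarrow> ('m \<times> nat + 'e \<times> nat \<Rightarrow> nat \<Rightarrow> 'a) \<Rightarrow> 'm + 'e \<Rightarrow> nat \<Rightarrow> 'a" where
  "merge_blocks t Y p q = Y (split_input p (q div t)) (q mod t)"

definition split_blocks :: "nat \<Rightarrow> ('m + 'e \<Rightarrow> nat \<Rightarrow> 'a) \<Rightarrow> 'm \<times> nat + 'e \<times> nat \<Rightarrow> nat \<Rightarrow> 'a" where
  "split_blocks t Y p q = Y (map_sum fst fst p) (case_sum snd snd p * t + q)"

text \<open>This is \<open>q div t * t + q mod t = q\<close>, valid also for \<open>t = 0\<close>.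
  The opposite composite need not be the identity: for positive \<open>t\<close>, merging ignores
  components from \<open>t\<close> on.\<close>

lemma merge_split_blocks [simp]: "merge_blocks t (split_blocks t Y) = Y"
proof (intro ext)
  fix p q
  show "merge_blocks t (split_blocks t Y) p q = Y p q"
    by (cases p) (simp_all add: merge_blocks_def split_blocks_def split_input_def)
qed

text \<open>By the previous identity \<open>merge_blocks t\<close> is surjective, which is all that
  a universal quantifier needs.\<close>

lemma all_merge_blocks_iff: "(\<forall>Y. P (merge_blocks t Y)) \<longleftrightarrow> (\<forall>Y. P Y)"
proof (intro iffI allI)
  fix Y assume "\<forall>Y. P (merge_blocks t Y)"
  then have "P (merge_blocks t (split_blocks t Y))" ..
  then show "P Y" by simp
qed simp

text \<open>Here \<open>input_size k n p\<close> counts copies instead of measuring a length: a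
  message \<open>i\<close> has \<open>k i\<close> copies, an edge has \<open>n\<close>.\<close>

lemma inputs_expand:
  "inputs (expand N k n) v =
    (\<lambda>(p, j). split_input p j) ` (SIGMA p:inputs N v. {..<input_size k n p})"
proof (intro equalityI subsetI)
  fix p assume "p \<in> inputs (expand N k n) v"
  then show "p \<in> (\<lambda>(p, j). split_input p j) ` (SIGMA p:inputs N v. {..<input_size k n p})"
    by (intro image_eqI[of _ _ "(map_sum fst fst p, case_sum snd snd p)"])
      (auto simp: inputs_def expand_def in_arcs_def split_input_def)
qed (auto simp: inputs_def expand_def in_arcs_def split_input_def)

lemma inj_split_input: "inj_on (\<lambda>(p, j). split_input p j) A"
proof -
  have "p = q \<and> i = j" if "split_input p i = split_input q j"
    for p q :: "'a + 'b" and i j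
    using that by (cases p; cases q) (simp_all add: split_input_def)
  then show ?thesis
    unfolding inj_on_def by fast
qed

section \<open>Transfer between a network and its expansion\<close>

lemma sum_lessThan_mult:
  fixes f :: "nat \<Rightarrow> 'a::comm_monoid_add"
  shows "(\<Sum>q<t * d. f q) = (\<Sum>j<d. \<Sum>r<t. f (j * t + r))"
  by (induction d) (simp_all add: sum_lessThan_add add.commute[of t] mult.commute[of t])

text \<open>The sum over split inputs is grouped by original input; then each pair of a copy
  \<open>j\<close> and a component \<open>r < t\<close> is replaced by the single index
  \<open>j * t + r\<close>.\<close>

lemma node_comb_expand:
  assumes "wf_network N"
  shows "node_comb scale (expand N k n) (\<lambda>_. t) t v c X =
    node_comb scale N (\<lambda>i. t * k i) (t * n) v (merge_blocks t c) (merge_blocks t X)"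
proof -
  let ?g = "\<lambda>p r. scale (c p r) (X p r)"
  let ?S = "SIGMA p:inputs N v. {..<input_size k n p}"
  have "node_comb scale (expand N k n) (\<lambda>_. t) t v c X =
      (\<Sum>p\<in>inputs (expand N k n) v. \<Sum>r<t. ?g p r)"
    unfolding node_comb_def by (intro sum.cong refl) (auto split: sum.splits)
  also have "\<dots> = (\<Sum>(p, j)\<in>?S. \<Sum>r<t. ?g (split_input p j) r)"
    unfolding inputs_expand
    by (subst sum.reindex[OF inj_split_input]) (simp add: case_prod_unfold)
  also have "\<dots> = (\<Sum>p\<in>inputs N v. \<Sum>j<input_size k n p. \<Sum>r<t. ?g (split_input p j) r)"
    by (subst sum.Sigma) (simp_all add: finite_inputs[OF assms])
  also have "\<dots> = (\<Sum>p\<in>inputs N v. \<Sum>q<t * input_size k n p.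
      scale (merge_blocks t c p q) (merge_blocks t X p q))"
    unfolding sum_lessThan_mult by (intro sum.cong refl) (simp add: merge_blocks_def)
  also have "\<dots> = node_comb scale N (\<lambda>i. t * k i) (t * n) v (merge_blocks t c) (merge_blocks t X)"
    unfolding node_comb_def by (intro sum.cong refl) (auto split: sum.splits)
  finally show ?thesis .
qed

lemma all_less_mult_iff:
  fixes t d :: nat
  shows "(\<forall>q<t * d. P (q div t) (q mod t)) \<longleftrightarrow> (\<forall>j<d. \<forall>r<t. P j r)"
proof (intro iffI allI impI)
  fix j r assume P: "\<forall>q<t * d. P (q div t) (q mod t)" and jr: "j < d" "r < t"
  have "j * t + r < Suc j * t"
    using jr by simp
  also have "\<dots> \<le> t * d"
    using jr by (metis Suc_leI mult.commute mult_le_mono1)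
  finally show "P j r"
    using P jr by (auto dest: spec[of _ "j * t + r"])
next
  fix q assume P: "\<forall>j<d. \<forall>r<t. P j r" and q: "q < t * d"
  then have "0 < t" by (cases t) auto
  with P q show "P (q div t) (q mod t)"
    by (simp add: less_mult_imp_div_less mult.commute)
qed

text \<open>Edge and decoding equations of the expansion involve the relevant part of
  \<open>X\<close> only through \<open>merge_blocks t X\<close>, and in those terms they are the
  equations of the original network.\<close>

lemma coeff_solution_expand:
  assumes N: "wf_network N"
  shows "coeff_solution scale (expand N k n) (\<lambda>_. t) t a b \<longleftrightarrow>
    coeff_solution scale N (\<lambda>i. t * k i) (t * n)
      (\<lambda>e q. merge_blocks t (a (e, q div t) (q mod t)))
      (\<lambda>v i q. merge_blocks t (b v (i, q div t) (q mod t)))"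
proof -
  let ?comb = "\<lambda>v c X. node_comb scale N (\<lambda>i. t * k i) (t * n) v (merge_blocks t c) X"
  let ?edges = "\<lambda>X. \<forall>e\<in>arcs (graph N). \<forall>q<t * n.
    X (Inr e) q = ?comb (tail (graph N) e) (a (e, q div t) (q mod t)) X"
  let ?decs = "\<lambda>X. \<forall>v\<in>receivers N. \<forall>i\<in>demands N v. \<forall>q<t * k i.
    ?comb v (b v (i, q div t) (q mod t)) X = X (Inl i) q"
  have ball_lessThan: "(\<forall>j\<in>{..<m}. P j) \<longleftrightarrow> (\<forall>j<m. P j)" for P and m :: nat
    by auto
  have edges: "?edges (merge_blocks t X) \<longleftrightarrow> (\<forall>e\<in>arcs (graph N). \<forall>j<n. \<forall>r<t.
      X (Inr (e, j)) r = ?comb (tail (graph N) e) (a (e, j) r) (merge_blocks t X))" for X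
    using all_less_mult_iff[of t n "\<lambda>j r. X (Inr (e, j)) r =
      ?comb (tail (graph N) e) (a (e, j) r) (merge_blocks t X)" for e]
    by (simp add: merge_blocks_def[of t X "Inr _"] split_input_def)
  have decs: "?decs (merge_blocks t X) \<longleftrightarrow> (\<forall>v\<in>receivers N. \<forall>i\<in>demands N v. \<forall>j<k i. \<forall>r<t.
      ?comb v (b v (i, j) r) (merge_blocks t X) = X (Inl (i, j)) r)" for X
    using all_less_mult_iff[of t "k i" "\<lambda>j r.
      ?comb v (b v (i, j) r) (merge_blocks t X) = X (Inl (i, j)) r" for v i]
    by (simp add: merge_blocks_def[of t X "Inl _"] split_input_def)
  have "coeff_solution scale (expand N k n) (\<lambda>_. t) t a b \<longleftrightarrow>
      (\<forall>X. ?edges (merge_blocks t X) \<longrightarrow> ?decs (merge_blocks t X))"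
    unfolding edges decs coeff_solution_def node_comb_expand[OF N]
    by (simp add: expand_def ball_lessThan)
  also have "\<dots> \<longleftrightarrow> (\<forall>X. ?edges X \<longrightarrow> ?decs X)"
    \<comment> \<open>Every assignment for the original network arises by merging, so
      \<open>X\<close> may replace \<open>merge_blocks t X\<close>.\<close>
    by (rule all_merge_blocks_iff)
  finally show ?thesis
    unfolding coeff_solution_def .
qed

lemma ex_coeff_solution_expand_iff:
  assumes "wf_network N"
  shows "(\<exists>a b. coeff_solution scale (expand N k n) (\<lambda>_. t) t a b) \<longleftrightarrow>
    (\<exists>a b. coeff_solution scale N (\<lambda>i. t * k i) (t * n) a b)"
proof
  assume "\<exists>a b. coeff_solution scale (expand N k n) (\<lambda>_. t) t a b"
  then show "\<exists>a b. coeff_solution scale N (\<lambda>i. t * k i) (t * n) a b"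
    unfolding coeff_solution_expand[OF assms] by (elim exE) (intro exI)
next
  assume "\<exists>a b. coeff_solution scale N (\<lambda>i. t * k i) (t * n) a b"
  then obtain a b where ab: "coeff_solution scale N (\<lambda>i. t * k i) (t * n) a b"
    by blast
  \<comment> \<open>Rows are split by \<open>j * t + r\<close> and columns by
    \<open>split_blocks\<close>; merging this family gives back exactly \<open>a\<close> and
    \<open>b\<close>.\<close>
  have "coeff_solution scale (expand N k n) (\<lambda>_. t) t
      (\<lambda>(e, j) r. split_blocks t (a e (j * t + r)))
      (\<lambda>v (i, j) r. split_blocks t (b v i (j * t + r)))"
    unfolding coeff_solution_expand[OF assms] using ab by simp
  then show "\<exists>a b. coeff_solution scale (expand N k n) (\<lambda>_. t) t a b"
    by blast
qed

theorem lemma2p2: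
  fixes scale :: "'r::{ring,monoid_mult} \<Rightarrow> 'g::{ab_group_add,finite} \<Rightarrow> 'g"
    and N :: "('v, 'e, 'm) network"
    and k :: "'m \<Rightarrow> nat"
    and n t :: nat
  assumes "left_module scale"
    and "wf_network N"
    and "n \<ge> 1"
    and "t \<ge> 1"
  shows "has_linear_solution scale N (\<lambda>i. t * k i) (t * n) \<longleftrightarrow>
    has_vector_linear_solution scale (expand N k n) t"
  \<comment> \<open>The cardinality condition is common to both sides, and
    \<open>1 \<le> t * n\<close> and \<open>1 \<le> t\<close> both hold, so only the existence of
    coefficients is left to compare.\<close>
  using assms(3,4) unfolding has_vector_linear_solution_def
  by (simp add: has_linear_solution_iff_coeff_solution assms(2) wf_network_expand
      ex_coeff_solution_expand_iff)

end
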